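(* Let $p$ be a prime and let $G$ be a transitive permutation group on a set of $p$ elements (i.e. a subgroup of the symmetric group of that set acting transitively on it). Then $G$ is doubly transitive or $G$ is solvable.
   Context: A permutation group $G$ on a set $\Omega$ is doubly transitive if it acts transitively on the set of ordered pairs $(i,j)\in\Omega\times\Omega$ with $i\neq j$. *)

theory Defs
  imports "HOL-Algebra.Algebra" "HOL-Computational_Algebra.Primes"
begin

text \<open>
  A permutation group on \<open>\<Omega>\<close> is a subgroup \<open>G\<close> of \<open>BijGroup \<Omega>\<close>. As a group it is
  \<open>(BijGroup \<Omega>)\<lparr>carrier := G\<rparr>\<close>; the natural action on \<open>\<Omega>\<close> is given by the identity map
  \<open>\<lambda>g. g\<close> into \<open>BijGroup \<Omega>\<close>.
\<close>

definition transitive_perm_group :: "'a set \<Rightarrow> ('a \<Rightarrow> 'a) set \<Rightarrow> bool"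
  where "transitive_perm_group \<Omega> G \<longleftrightarrow>
    transitive_action ((BijGroup \<Omega>)\<lparr>carrier := G\<rparr>) \<Omega> (\<lambda>g. g)"

definition distinct_pairs :: "'a set \<Rightarrow> ('a \<times> 'a) set"
  where "distinct_pairs \<Omega> = {(i, j). i \<in> \<Omega> \<and> j \<in> \<Omega> \<and> i \<noteq> j}"

text \<open>
  The diagonal action on pairs is restricted to \<open>distinct_pairs \<Omega>\<close> because the elements of
  \<open>BijGroup\<close> are extensional functions.
\<close>

definition doubly_transitive :: "'a set \<Rightarrow> ('a \<Rightarrow> 'a) set \<Rightarrow> bool"
  where "doubly_transitive \<Omega> G \<longleftrightarrow>
    transitive_action ((BijGroup \<Omega>)\<lparr>carrier := G\<rparr>) (distinct_pairs \<Omega>)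
      (\<lambda>g. \<lambda>(i, j)\<in>distinct_pairs \<Omega>. (g i, g j))"

lemma transitive_perm_group_iff:
  assumes "subgroup G (BijGroup \<Omega>)"
  shows "transitive_perm_group \<Omega> G \<longleftrightarrow> (\<forall>i\<in>\<Omega>. \<forall>j\<in>\<Omega>. \<exists>g\<in>G. g i = j)"
proof -
  interpret B: group "BijGroup \<Omega>" by (rule group_BijGroup)
  have "group_hom ((BijGroup \<Omega>)\<lparr>carrier := G\<rparr>) (BijGroup \<Omega>) (\<lambda>g. g)"
    using assms B.subgroup_imp_group[OF assms] subgroup.subset[OF assms]
    by (auto simp: group_hom_def group_hom_axioms_def hom_def intro: group_BijGroup)
  then show ?thesis
    by (auto simp: transitive_perm_group_def transitive_action_def
        transitive_action_axioms_def group_action_def)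
qed

lemma doubly_transitive_iff:
  assumes "subgroup G (BijGroup \<Omega>)"
  shows "doubly_transitive \<Omega> G \<longleftrightarrow>
    (\<forall>i\<in>\<Omega>. \<forall>j\<in>\<Omega>. \<forall>k\<in>\<Omega>. \<forall>l\<in>\<Omega>. i \<noteq> j \<longrightarrow> k \<noteq> l \<longrightarrow> (\<exists>g\<in>G. g i = k \<and> g j = l))"
proof -
  interpret B: group "BijGroup \<Omega>" by (rule group_BijGroup)
  let ?D = "distinct_pairs \<Omega>"
  let ?f = "\<lambda>g. \<lambda>(i, j)\<in>?D. (g i, g j)"
  have GB: "G \<subseteq> Bij \<Omega>"
    using subgroup.subset[OF assms] by (simp add: BijGroup_def)
  have f_Bij: "?f g \<in> Bij ?D" if "g \<in> Bij \<Omega>" for g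
  proof -
    have g: "bij_betw g \<Omega> \<Omega>" using that by (simp add: Bij_def)
    have "bij_betw (\<lambda>(i, j). (g i, g j)) ?D ?D"
      unfolding bij_betw_def
    proof
      show "inj_on (\<lambda>(i, j). (g i, g j)) ?D"
        using g by (auto simp: inj_on_def distinct_pairs_def bij_betw_def)
      show "(\<lambda>(i, j). (g i, g j)) ` ?D = ?D"
      proof
        show "(\<lambda>(i, j). (g i, g j)) ` ?D \<subseteq> ?D"
          using g by (auto simp: inj_on_def distinct_pairs_def bij_betw_def)
        show "?D \<subseteq> (\<lambda>(i, j). (g i, g j)) ` ?D"
        proof
          fix x assume "x \<in> ?D"
          then obtain k l where x: "x = (k, l)" "k \<in> \<Omega>" "l \<in> \<Omega>" "k \<noteq> l"
            by (auto simp: distinct_pairs_def)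
          obtain i j where "i \<in> \<Omega>" "g i = k" "j \<in> \<Omega>" "g j = l"
            using x g by (metis bij_betw_def imageE)
          with x show "x \<in> (\<lambda>(i, j). (g i, g j)) ` ?D"
            by (force simp: distinct_pairs_def)
        qed
      qed
    qed
    then show ?thesis by (simp add: Bij_def)
  qed
  have f_mult: "?f (g \<otimes>\<^bsub>BijGroup \<Omega>\<^esub> h) = ?f g \<otimes>\<^bsub>BijGroup ?D\<^esub> ?f h"
    if "g \<in> Bij \<Omega>" "h \<in> Bij \<Omega>" for g h
  proof -
    have "h \<in> \<Omega> \<rightarrow> \<Omega>" "inj_on h \<Omega>"
      using that Bij_imp_funcset by (auto simp: Bij_def bij_betw_def)
    then show ?thesis
      using that f_Bij[OF that(1)] f_Bij[OF that(2)]
      by (auto simp: BijGroup_def compose_def restrict_def distinct_pairs_def fun_eq_iff inj_on_def)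
  qed
  have "group_hom ((BijGroup \<Omega>)\<lparr>carrier := G\<rparr>) (BijGroup ?D) ?f"
    using B.subgroup_imp_group[OF assms] group_BijGroup[of ?D] GB f_Bij f_mult
    by (auto simp: group_hom_def group_hom_axioms_def hom_def) (auto simp: BijGroup_def)
  then show ?thesis
    by (auto simp: doubly_transitive_def transitive_action_def
        transitive_action_axioms_def group_action_def distinct_pairs_def)
qed

end

(* Following P. Mueller.  By Sylow, G contains a p-cycle, so Omega may be identified with Z/p such
   that x |-> x + 1 lies in G.  If G is not doubly transitive, an orbit of G on pairs of distinct
   points has the form {(x, y). x - y in U} with U a nonempty proper subset of the nonzero residues,
   and every element of G preserves the relation x - y in U.  The same holds for the complement of
   U, so U may be taken to have fewer than p/2 elements.

   Every f in G is then affine.  For a polynomial q of degree n < p representing f, the residues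
   f(x + u) - f(x) with u in U run through U, whence the sum of q(x + u)^k over U equals the sum of
   (q(x) + u)^k over U.  Let r <= card U be least such that the r-th power sum of U does not vanish
   mod p.  For 1 <= k <= r, the sum of q(x + u)^k minus card U * q(x)^k is then the k-th power sum of
   U for all x, whereas for k n >= r its coefficient at degree k n - r is nonzero.  If n >= 2, the
   least k with k n >= r also satisfies k n < p, and either k < r (so that the k-th power sum
   vanishes) or k = r = 1 < n, a contradiction.  Hence G embeds in the affine group of Z/p, whose
   commutators are translations, which commute. *)

theory Submission
  imports Defs "HOL-Number_Theory.Residues" "HOL-Computational_Algebra.Polynomial"
begin

section \<open>Integer polynomials modulo a prime: roots, interpolation, translation\<close>

text \<open>Lagrange's bound on the number of roots over the field Z/p. Synthetic division gives q =
  (x - a) s + q(a); at any other point b of the set, p divides (b - a) s(b) but not b - a, so b is a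
  root of s modulo p and the induction applies to s.\<close>

lemma prime_dvd_coeff_of_roots_mod:
  fixes p :: int and q :: "int poly"
  assumes "Factorial_Ring.prime p" "finite A" "inj_on (\<lambda>x. x mod p) A" "degree q < card A"
    and "\<And>a. a \<in> A \<Longrightarrow> p dvd poly q a"
  shows "p dvd coeff q i"
  using assms(2-)
proof (induction A arbitrary: q i rule: finite_induct)
  case empty
  then show ?case by simp
next
  case (insert a A)
  define s where "s = synthetic_div q a"
  have q_eq: "q + smult a s = pCons (poly q a) s"
    unfolding s_def by (rule synthetic_div_correct)
  have p_a: "p dvd poly q a" using insert.prems by simp
  have "p dvd coeff s j" for j
  \<comment> \<open>Constant \<open>q\<close> is treated apart: the bound
    \<open>degree s < card A\<close> fails for it when \<open>A\<close> is empty.\<close>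
  proof (cases "degree q = 0")
    case True
    then have "s = 0" by (simp add: s_def synthetic_div_eq_0_iff)
    then show ?thesis by simp
  next
    case False
    show ?thesis
    proof (rule insert.IH)
      show "inj_on (\<lambda>x. x mod p) A" using insert.prems by simp
      show "degree s < card A"
        using insert.prems(2) insert.hyps False by (simp add: s_def degree_synthetic_div)
      fix b assume b: "b \<in> A"
      have "poly q b + a * poly s b = poly q a + b * poly s b"
        using arg_cong[OF q_eq, of "\<lambda>f. poly f b"] by simp
      then have "(b - a) * poly s b = poly q b - poly q a"
        by (simp add: algebra_simps)
      moreover have "p dvd poly q b - poly q a" using insert.prems b by simp
      moreover have "\<not> p dvd b - a"
        using insert.prems(1) insert.hyps(2) b by (auto simp: inj_on_def mod_eq_dvd_iff)
      ultimately show "p dvd poly s b"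
        using assms(1) by (metis prime_dvd_mult_iff)
    qed
  qed
  moreover have "coeff q i = coeff (pCons (poly q a) s) i - a * coeff s i"
    using arg_cong[OF q_eq, of "\<lambda>f. coeff f i"] by simp
  ultimately show ?case
    using p_a by (auto simp: coeff_pCons split: nat.splits)
qed

lemma fermat_int:
  fixes p a :: int
  assumes "Factorial_Ring.prime p" "\<not> p dvd a"
  shows "[a ^ (nat p - 1) = 1] (mod p)"
proof -
  have p: "p > 0" "Factorial_Ring.prime (nat p)"
    using assms(1) prime_gt_0_int by (blast, metis prime_int_nat_transfer)
  define b where "b = nat (a mod p)"
  have b: "int b = a mod p" using p by (simp add: b_def)
  have "\<not> nat p dvd b"
  proof
    assume "nat p dvd b"
    then have "p dvd a mod p"
      using p b by (metis int_dvd_int_iff int_nat_eq order_less_imp_le)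
    then show False using assms(2) by (simp add: dvd_mod_iff)
  qed
  then have "[b ^ (nat p - 1) = 1] (mod nat p)"
    using fermat_theorem p by blast
  then have "[int b ^ (nat p - 1) = 1] (mod p)"
    using p by (metis cong_int_iff int_nat_eq of_nat_1 of_nat_power order_less_imp_le)
  then show ?thesis
    unfolding b by (simp add: cong_def power_mod)
qed

text \<open>Every map on residues is a polynomial map of degree below p. The last clause makes
  \<open>degree q\<close> the true degree modulo p, so that powers of \<open>q\<close> keep a
  leading coefficient prime to p.\<close>

lemma interpolation_mod_prime:
  fixes p :: int and f :: "int \<Rightarrow> int"
  assumes "Factorial_Ring.prime p" and f: "\<And>x. [f (x mod p) = f x] (mod p)"
  obtains q :: "int poly" where "degree q < nat p" "\<And>x. [poly q x = f x] (mod p)"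
    "degree q = 0 \<or> \<not> p dvd lead_coeff q"
proof -
  have p: "p > 1" using assms(1) by (rule prime_gt_1_int)
  \<comment> \<open>By Fermat, 1 - (x - a)^(p - 1) is 1 modulo p if x is congruent to a, and 0
    otherwise.\<close>
  define Q where "Q = (\<Sum>a\<in>{0..<p}. smult (f a) (1 - [:- a, 1:] ^ (nat p - 1)))"
  define R where "R q \<longleftrightarrow> (\<forall>x. [poly q x = f x] (mod p))" for q :: "int poly"
  have "degree Q \<le> nat p - 1"
    unfolding Q_def
    by (intro degree_sum_le order.trans[OF degree_smult_le] degree_diff_le)
       (auto simp: degree_linear_power)
  then have deg_Q: "degree Q < nat p" using p by simp
  have "R Q"
    unfolding R_def
  proof
    fix x
    have "[poly Q x = (\<Sum>a\<in>{0..<p}. if a = x mod p then f a else 0)] (mod p)"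
      unfolding Q_def poly_sum
    proof (rule cong_sum)
      fix a assume a: "a \<in> {0..<p}"
      show "[poly (smult (f a) (1 - [:- a, 1:] ^ (nat p - 1))) x = (if a = x mod p then f a else 0)] (mod p)"
      proof (cases "a = x mod p")
        case True
        then have "p dvd (x - a) ^ (nat p - 1)"
          using p by (intro dvd_power_le[of p _ 1, simplified]) auto
        then have "p dvd f a * (1 - (x - a) ^ (nat p - 1)) - f a"
          by (simp add: algebra_simps)
        then show ?thesis
          using True by (simp add: cong_iff_dvd_diff)
      next
        case False
        then have "\<not> p dvd x - a"
          using a by (metis atLeastLessThan_iff mod_eq_dvd_iff mod_pos_pos_trivial)
        then have "p dvd (x - a) ^ (nat p - 1) - 1"
          using fermat_int[OF assms(1)] by (simp add: cong_iff_dvd_diff)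
        then have "p dvd f a * (1 - (x - a) ^ (nat p - 1))"
          by (metis dvd_mult dvd_minus_iff minus_diff_eq)
        then show ?thesis
          using False by (simp add: cong_0_iff)
      qed
    qed
    also have "(\<Sum>a\<in>{0..<p}. if a = x mod p then f a else 0) = f (x mod p)"
      using p by simp
    also have "[f (x mod p) = f x] (mod p)" by (rule f)
    finally show "[poly Q x = f x] (mod p)" .
  qed
  then obtain q where q: "R q" "\<And>q'. R q' \<Longrightarrow> degree q \<le> degree q'"
    using ex_has_least_nat[of R Q degree] by blast
  show thesis
  proof (rule that)
    show "degree q < nat p" using q(2)[OF \<open>R Q\<close>] deg_Q by simp
    show "[poly q x = f x] (mod p)" for x using q(1) by (simp add: R_def)
    show "degree q = 0 \<or> \<not> p dvd lead_coeff q"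
    proof (rule ccontr)
      assume *: "\<not> (degree q = 0 \<or> \<not> p dvd lead_coeff q)"
      \<comment> \<open>Removing a leading term divisible by p keeps all values modulo p and lowers
        the degree, against the minimal choice of \<open>q\<close>.\<close>
      let ?m = "Polynomial.monom (lead_coeff q) (degree q)"
      have "[poly (q - ?m) x = poly q x] (mod p)" for x
        using * by (simp add: cong_iff_dvd_diff poly_monom)
      then have "R (q - ?m)"
        using q(1) cong_trans unfolding R_def by blast
      moreover have "degree (q - ?m) < degree q"
      proof (rule degree_lessI)
        show "q - ?m \<noteq> 0 \<or> 0 < degree q" using * by simp
        show "\<forall>k\<ge>degree q. coeff (q - ?m) k = 0"
          by (auto simp: coeff_eq_0)
      qed
      ultimately show False using q(2) by fastforce
    qed
  qed
qed

lemma pcompose_power: "pcompose (f ^ n) g = pcompose f g ^ n" for f g :: "'a::comm_semiring_1 poly"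
  by (induction n) (auto simp: pcompose_mult pcompose_1)

text \<open>Binomial expansion of each (x + u)^j. For \<open>j < i\<close> the truncated exponent
  \<open>j - i\<close> does no harm, since \<open>j choose i\<close> is 0 there.\<close>

lemma coeff_pcompose_translate:
  fixes g :: "'a::comm_semiring_1 poly"
  assumes "degree g \<le> N"
  shows "coeff (pcompose g [:u, 1:]) i = (\<Sum>j\<le>N. coeff g j * of_nat (j choose i) * u ^ (j - i))"
proof -
  have "pcompose g [:u, 1:] = pcompose (\<Sum>j\<le>N. smult (coeff g j) ([:0, 1:] ^ j)) [:u, 1:]"
    using poly_as_sum_of_monoms'[OF assms] by (simp add: monom_altdef)
  also have "\<dots> = (\<Sum>j\<le>N. smult (coeff g j) ([:u, 1:] ^ j))"
    by (simp add: pcompose_sum pcompose_smult pcompose_power pcompose_pCons)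
  also have "coeff \<dots> i = (\<Sum>j\<le>N. coeff g j * of_nat (j choose i) * u ^ (j - i))"
    unfolding coeff_sum
  proof (rule sum.cong)
    fix j
    show "coeff (smult (coeff g j) ([:u, 1:] ^ j)) i = coeff g j * of_nat (j choose i) * u ^ (j - i)"
    proof (cases "i \<le> j")
      case True
      then show ?thesis by (simp add: coeff_linear_poly_power mult.assoc)
    next
      case False
      then have "coeff ([:u, 1:] ^ j) i = 0"
        by (intro coeff_eq_0) (auto intro: le_less_trans[OF degree_power_le])
      with False show ?thesis by (simp add: binomial_eq_0)
    qed
  qed simp
  finally show ?thesis .
qed

section \<open>Power sums of a set of residues and sums over its translates\<close>

text \<open>The coefficient of g at j contributes a multiple of \<open>j choose (N - r)\<close>
  times the power sum of exponent \<open>j - (N - r)\<close>. The binomial kills j < N - r, and the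
  hypothesis kills the exponents strictly between 0 and r. Only j = N - r, where the power sum is
  \<open>card U\<close>, and j = N survive.\<close>

lemma coeff_sum_translates_mod:
  fixes p :: int and g :: "int poly"
  assumes "degree g \<le> N" "0 < r" "r \<le> N"
    and "\<And>j. 0 < j \<Longrightarrow> j < r \<Longrightarrow> p dvd (\<Sum>u\<in>U. u ^ j)"
  shows "[coeff (\<Sum>u\<in>U. pcompose g [:u, 1:]) (N - r) =
    of_nat (card U) * coeff g (N - r) + coeff g N * of_nat (N choose r) * (\<Sum>u\<in>U. u ^ r)] (mod p)"
proof -
  let ?S = "\<lambda>j. \<Sum>u\<in>U. u ^ j" and ?i = "N - r"
  let ?t = "\<lambda>j. coeff g j * of_nat (j choose ?i) * ?S (j - ?i)"
  have "coeff (\<Sum>u\<in>U. pcompose g [:u, 1:]) ?i =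
      (\<Sum>u\<in>U. \<Sum>j\<le>N. coeff g j * of_nat (j choose ?i) * u ^ (j - ?i))"
    by (simp add: coeff_sum coeff_pcompose_translate[OF assms(1)])
  also have "\<dots> = (\<Sum>j\<le>N. ?t j)"
    by (subst sum.swap) (simp add: sum_distrib_left)
  also have "\<dots> = (\<Sum>j\<in>{..N} - {?i, N}. ?t j) + (\<Sum>j\<in>{?i, N}. ?t j)"
    by (rule sum.subset_diff) auto
  also have "(\<Sum>j\<in>{?i, N}. ?t j) = ?t ?i + ?t N"
  proof -
    have "?i \<noteq> N" using assms(2,3) by arith
    then show ?thesis by (subst sum.insert) simp_all
  qed
  also have "\<dots> = of_nat (card U) * coeff g (N - r) + coeff g N * of_nat (N choose r) * ?S r"
    using assms(3) by (simp add: binomial_symmetric[of r N] mult.commute)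
  finally have eq: "coeff (\<Sum>u\<in>U. pcompose g [:u, 1:]) ?i = (\<Sum>j\<in>{..N} - {?i, N}. ?t j) +
      (of_nat (card U) * coeff g (N - r) + coeff g N * of_nat (N choose r) * ?S r)" .
  have "p dvd (\<Sum>j\<in>{..N} - {?i, N}. ?t j)"
  proof (rule dvd_sum)
    fix j assume "j \<in> {..N} - {?i, N}"
    then have "j < ?i \<or> (0 < j - ?i \<and> j - ?i < r)"
      using assms(2,3) by (simp only: Diff_iff atMost_iff insert_iff empty_iff) arith
    then show "p dvd ?t j"
    proof (elim disjE conjE)
      assume "j < ?i"
      then show ?thesis by (simp add: binomial_eq_0)
    next
      assume "0 < j - ?i" "j - ?i < r"
      then show ?thesis using assms(4) by (intro dvd_mult)
    qed
  qed
  then show ?thesis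
    unfolding eq by (simp add: cong_iff_dvd_diff)
qed

text \<open>If all power sums of exponents 1 to \<open>card U\<close> vanished modulo p, then p
  would divide h(0) * \<open>card U\<close> for the monic polynomial h with root set U. But h(0) is
  up to sign the product of the elements of U, and 0 < \<open>card U\<close> < p.\<close>

lemma least_power_sum_not_dvd:
  fixes p :: int
  assumes "Factorial_Ring.prime p" "U \<subseteq> {0<..<p}" "U \<noteq> {}"
  obtains r where "0 < r" "r \<le> card U" "\<not> p dvd (\<Sum>u\<in>U. u ^ r)"
    "\<And>j. 0 < j \<Longrightarrow> j < r \<Longrightarrow> p dvd (\<Sum>u\<in>U. u ^ j)"
proof -
  have fin: "finite U" using assms(2) finite_subset by blast
  have "\<exists>r. 0 < r \<and> r \<le> card U \<and> \<not> p dvd (\<Sum>u\<in>U. u ^ r)"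
  proof (rule ccontr)
    assume "\<not> ?thesis"
    then have S: "p dvd (\<Sum>u\<in>U. u ^ r)" if "0 < r" "r \<le> card U" for r using that by blast
    \<comment> \<open>Summing \<open>h u = 0\<close> over \<open>U\<close> leaves only the contribution of the constant term of \<open>h\<close>.\<close>
    define h :: "int poly" where "h = (\<Prod>u\<in>U. [:- u, 1:])"
    have deg: "degree h = card U"
      unfolding h_def by (subst degree_prod_eq_sum_degree) auto
    have "poly h u = 0" if "u \<in> U" for u
      using that fin by (auto simp: h_def poly_prod)
    then have "0 = (\<Sum>u\<in>U. poly h u)" by simp
    also have "\<dots> = (\<Sum>u\<in>U. \<Sum>j\<le>card U. coeff h j * u ^ j)"
      by (simp add: poly_altdef deg)
    also have "\<dots> = (\<Sum>j\<le>card U. coeff h j * (\<Sum>u\<in>U. u ^ j))"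
      by (subst sum.swap) (simp add: sum_distrib_left)
    also have "\<dots> = coeff h 0 * int (card U) + (\<Sum>j\<in>{0<..card U}. coeff h j * (\<Sum>u\<in>U. u ^ j))"
    proof -
      have "{..card U} = insert 0 {0<..card U}" by auto
      then show ?thesis by simp
    qed
    finally have "coeff h 0 * int (card U) = - (\<Sum>j\<in>{0<..card U}. coeff h j * (\<Sum>u\<in>U. u ^ j))"
      by simp
    moreover have "p dvd (\<Sum>j\<in>{0<..card U}. coeff h j * (\<Sum>u\<in>U. u ^ j))"
      using S by (intro dvd_sum) auto
    ultimately have "p dvd coeff h 0 * int (card U)" by simp
    then consider "p dvd coeff h 0" | "p dvd int (card U)"
      using assms(1) by (auto simp: prime_dvd_mult_iff)
    then show False
    proof cases
      case 1
      have "coeff h 0 = (\<Prod>u\<in>U. - u)"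
        by (simp add: poly_0_coeff_0[symmetric] h_def poly_prod)
      with 1 obtain u where "u \<in> U" "p dvd u"
        using assms(1) fin by (auto simp: prime_dvd_prod_iff)
      then show False using assms(2) zdvd_not_zless by auto
    next
      case 2
      have "card U \<le> card {0<..<p}" using assms(2) by (intro card_mono) auto
      moreover have "card U > 0" using assms(3) fin by (simp add: card_gt_0_iff)
      ultimately show False using 2 zdvd_not_zless[of "int (card U)" p] by auto
    qed
  qed
  then obtain r where r: "0 < r \<and> r \<le> card U \<and> \<not> p dvd (\<Sum>u\<in>U. u ^ r)"
    and min: "\<And>j. j < r \<Longrightarrow> \<not> (0 < j \<and> j \<le> card U \<and> \<not> p dvd (\<Sum>u\<in>U. u ^ j))"
    using exists_least_iff[of "\<lambda>r. 0 < r \<and> r \<le> card U \<and> \<not> p dvd (\<Sum>u\<in>U. u ^ r)"] by blast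
  show thesis
    using r min by (intro that[of r]) auto
qed

lemma prime_not_dvd_choose:
  fixes p :: nat
  assumes "Factorial_Ring.prime p" "N < p" "r \<le> N"
  shows "\<not> p dvd (N choose r)"
proof
  assume "p dvd (N choose r)"
  then have "p dvd fact N"
    using binomial_fact_lemma[OF assms(3)] by (metis dvd_mult)
  then show False
    using assms by (simp add: prime_dvd_fact_iff)
qed

text \<open>The map u to f(x + u) - f(x) modulo p is injective from the finite set U to itself,
  hence permutes U. The sum is therefore that of (u + f(x))^k over U, and in its binomial expansion
  only the terms j = 0 and j = k are not multiples of p.\<close>

lemma sum_powers_translates_mod:
  fixes p :: int and f :: "int \<Rightarrow> int"
  assumes "U \<subseteq> {0<..<p}"
    and inj: "\<And>x y. [f x = f y] (mod p) \<Longrightarrow> [x = y] (mod p)"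
    and pres: "\<And>x u. u \<in> U \<Longrightarrow> (f (x + u) - f x) mod p \<in> U"
    and "0 < k" and S: "\<And>j. 0 < j \<Longrightarrow> j < k \<Longrightarrow> p dvd (\<Sum>u\<in>U. u ^ j)"
  shows "[(\<Sum>u\<in>U. f (x + u) ^ k) = of_nat (card U) * f x ^ k + (\<Sum>u\<in>U. u ^ k)] (mod p)"
proof -
  have fin: "finite U" using assms(1) finite_subset by blast
  define t where "t u = (f (x + u) - f x) mod p" for u
  have "inj_on t U"
  proof
    fix u v assume uv: "u \<in> U" "v \<in> U" "t u = t v"
    then have "[f (x + u) - f x + f x = f (x + v) - f x + f x] (mod p)"
      unfolding t_def cong_def[symmetric] by (intro cong_add) auto
    then have "[x + u = x + v] (mod p)" using inj by simp
    then have "[u = v] (mod p)" by (simp add: cong_add_lcancel)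
    moreover have "0 < u" "u < p" "0 < v" "v < p" using uv assms(1) by auto
    ultimately show "u = v" by (simp add: cong_def)
  qed
  moreover have "t ` U \<subseteq> U" using pres by (auto simp: t_def)
  ultimately have bij: "bij_betw t U U"
    using fin by (simp add: bij_betw_def endo_inj_surj)
  have "[(\<Sum>u\<in>U. f (x + u) ^ k) = (\<Sum>u\<in>U. (t u + f x) ^ k)] (mod p)"
  proof (intro cong_sum cong_pow)
    fix u assume "u \<in> U"
    have "[f (x + u) - f x + f x = t u + f x] (mod p)"
      unfolding t_def by (intro cong_add) (auto simp: cong_def)
    then show "[f (x + u) = t u + f x] (mod p)" by simp
  qed
  also have "(\<Sum>u\<in>U. (t u + f x) ^ k) = (\<Sum>u\<in>U. (u + f x) ^ k)"
    by (rule sum.reindex_bij_betw[OF bij])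
  also have "\<dots> = (\<Sum>j\<le>k. of_nat (k choose j) * f x ^ (k - j) * (\<Sum>u\<in>U. u ^ j))"
    unfolding binomial_ring by (subst sum.swap) (simp add: sum_distrib_left sum_distrib_right mult_ac)
  \<comment> \<open>Keeping the index set \<open>{..k}\<close> and inserting zeros allows a termwise
    congruence.\<close>
  also have "[\<dots> = (\<Sum>j\<le>k. if j \<in> {0, k} then of_nat (k choose j) * f x ^ (k - j) * (\<Sum>u\<in>U. u ^ j) else 0)] (mod p)"
  proof (rule cong_sum)
    fix j assume "j \<in> {..k}"
    then consider "j \<in> {0, k}" | "0 < j" "j < k" "j \<notin> {0, k}" by fastforce
    then show "[of_nat (k choose j) * f x ^ (k - j) * (\<Sum>u\<in>U. u ^ j) =
       (if j \<in> {0, k} then of_nat (k choose j) * f x ^ (k - j) * (\<Sum>u\<in>U. u ^ j) else 0)] (mod p)"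
      by cases (use S in \<open>simp_all add: cong_0_iff\<close>)
  qed
  also have "(\<Sum>j\<le>k. if j \<in> {0, k} then of_nat (k choose j) * f x ^ (k - j) * (\<Sum>u\<in>U. u ^ j) else 0)
     = (\<Sum>j\<in>{0, k}. of_nat (k choose j) * f x ^ (k - j) * (\<Sum>u\<in>U. u ^ j))"
    by (subst sum.inter_restrict[symmetric]) (auto intro: sum.cong)
  also have "\<dots> = of_nat (card U) * f x ^ k + (\<Sum>u\<in>U. u ^ k)"
    using assms(4) by simp
  finally show ?thesis .
qed

section \<open>Permutations of Z/p preserving a small set of differences are affine\<close>

text \<open>Here \<open>f\<close> is a permutation of Z/p lifted to the integers, so it is
  determined only modulo p. The bound on \<open>card U\<close> keeps the degree of the auxiliary
  polynomial \<open>T\<close> below p, so that its values modulo p determine its coefficients modulo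
  p.\<close>

lemma affine_mod_prime_of_preserves_differences:
  fixes p :: int and f :: "int \<Rightarrow> int"
  assumes "Factorial_Ring.prime p" "U \<subseteq> {0<..<p}" "U \<noteq> {}" "2 * int (card U) < p"
    and f: "\<And>x. [f (x mod p) = f x] (mod p)"
    and inj: "\<And>x y. [f x = f y] (mod p) \<Longrightarrow> [x = y] (mod p)"
    and pres: "\<And>x u. u \<in> U \<Longrightarrow> (f (x + u) - f x) mod p \<in> U"
  shows "\<exists>a b. \<forall>x. [f x = a * x + b] (mod p)"
proof -
  obtain q :: "int poly" where q: "degree q < nat p" "\<And>x. [poly q x = f x] (mod p)"
    "degree q = 0 \<or> \<not> p dvd lead_coeff q"
    using interpolation_mod_prime[OF assms(1), of f] f by blast
  obtain r where r: "0 < r" "r \<le> card U" "\<not> p dvd (\<Sum>u\<in>U. u ^ r)"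
    "\<And>j. 0 < j \<Longrightarrow> j < r \<Longrightarrow> p dvd (\<Sum>u\<in>U. u ^ j)"
    using least_power_sum_not_dvd[OF assms(1-3)] by blast
  define n where "n = degree q"
  have "n \<le> 1"
  proof (rule ccontr)
    assume "\<not> n \<le> 1"
    then have n: "n \<ge> 2" by simp
    \<comment> \<open>The least \<open>k\<close> with \<open>r \<le> k * n\<close>; then still \<open>k * n < p\<close>.\<close>
    define k where "k = (r + n - 1) div n"
    define N where "N = k * n"
    have N_ge: "r \<le> N"
    proof -
      have "r + n - 1 < N + n"
        unfolding N_def k_def using n div_mult_mod_eq[of "r + n - 1" n] mod_less_divisor[of n "r + n - 1"]
        by linarith
      then show ?thesis using n by simp
    qed
    have N_le: "N \<le> r + n - 1"
      unfolding N_def k_def by simp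
    have "k > 0" using N_ge r by (auto simp: N_def intro: gr0I)
    \<comment> \<open>If k >= r, then r n <= r + n - 1, that is (r - 1)(n - 1) <= 0, which forces r
      = 1.\<close>
    have k_le: "k < r \<or> (k = 1 \<and> r = 1)"
    proof (cases "k < r")
      case False
      then have "r * n \<le> r + n - 1" using N_le unfolding N_def
        by (meson le_trans mult_le_mono1 not_less)
      moreover obtain r' n' where "r = Suc r'" "n = Suc (Suc n')"
        using r n by (metis add_2_eq_Suc gr0_implies_Suc le_add_diff_inverse)
      ultimately have "r = 1" by (auto simp: algebra_simps)
      then have "k = 1" using n by (simp add: k_def)
      with \<open>r = 1\<close> show ?thesis by simp
    qed simp
    \<comment> \<open>For n <= r, N <= r + n - 1 < 2 r <= 2 \<open>card U\<close> < p. For n > r, k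
      n < 2 n, so k = 1 and N is the degree of \<open>q\<close>.\<close>
    have "N < nat p"
    proof (cases "n \<le> r")
      case True
      then show ?thesis using N_le r assms(4) by linarith
    next
      case False
      then have "k * n < 2 * n" using N_le unfolding N_def by linarith
      then have "k = 1" using \<open>k > 0\<close> by simp
      then show ?thesis using q by (simp add: N_def n_def)
    qed
    define S where "S = (\<lambda>j. \<Sum>u\<in>U. u ^ j)"
    \<comment> \<open>Modulo \<open>p\<close> all values of \<open>T\<close> are \<open>S k\<close>, yet its coefficient at \<open>N - r\<close> is nonzero.\<close>
    define T where "T = (\<Sum>u\<in>U. pcompose (q ^ k) [:u, 1:]) - smult (of_nat (card U)) (q ^ k)"
    have deg_qk: "degree (q ^ k) = N"
      unfolding N_def n_def by (rule degree_power_eq) (use n in \<open>auto simp: n_def\<close>)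
    have T_coeff: "\<not> p dvd coeff T (N - r)"
    proof -
      have "[coeff T (N - r) = of_nat (card U) * coeff (q ^ k) (N - r)
          + coeff (q ^ k) N * of_nat (N choose r) * S r - of_nat (card U) * coeff (q ^ k) (N - r)] (mod p)"
        unfolding T_def S_def coeff_diff coeff_smult
        using coeff_sum_translates_mod[of "q ^ k" N r p U] deg_qk r N_ge
        by (intro cong_diff cong_refl) auto
      also have "coeff (q ^ k) N = lead_coeff q ^ k"
        using deg_qk by (metis lead_coeff_power)
      finally have "[coeff T (N - r) = lead_coeff q ^ k * of_nat (N choose r) * S r] (mod p)"
        by simp
      moreover have "\<not> p dvd int (N choose r)"
      proof -
        have "Factorial_Ring.prime (nat p)" using assms(1) prime_int_nat_transfer by blast
        then have "\<not> nat p dvd (N choose r)"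
          using prime_not_dvd_choose \<open>N < nat p\<close> N_ge by blast
        then show ?thesis using prime_gt_0_int[OF assms(1)]
          by (metis int_dvd_int_iff int_nat_eq less_imp_le)
      qed
      moreover have "\<not> p dvd lead_coeff q ^ k"
        using q(3) n assms(1) prime_dvd_power by (auto simp: n_def)
      ultimately show ?thesis
        using assms(1) r(3) by (simp add: cong_dvd_iff prime_dvd_mult_iff S_def)
    qed
    have "p dvd poly (T - [:S k:]) x" for x
    proof -
      have S0: "p dvd (\<Sum>u\<in>U. u ^ j)" if "0 < j" "j < k" for j
        using r(4)[of j] that k_le by auto
      have "[poly (T - [:S k:]) x =
          (\<Sum>u\<in>U. f (x + u) ^ k) - of_nat (card U) * f x ^ k - S k] (mod p)"
      proof -
        have "poly (T - [:S k:]) x =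
            (\<Sum>u\<in>U. poly q (x + u) ^ k) - of_nat (card U) * poly q x ^ k - S k"
          by (simp add: T_def poly_sum poly_pcompose add.commute[of x])
        then show ?thesis
          by (simp only:) (intro cong_diff cong_sum cong_mult cong_pow cong_refl q(2))
      qed
      also have "[(\<Sum>u\<in>U. f (x + u) ^ k) - of_nat (card U) * f x ^ k - S k =
          of_nat (card U) * f x ^ k + S k - of_nat (card U) * f x ^ k - S k] (mod p)"
      proof -
        have "[(\<Sum>u\<in>U. f (x + u) ^ k) = of_nat (card U) * f x ^ k + S k] (mod p)"
          unfolding S_def
          by (rule sum_powers_translates_mod[OF assms(2)]) (fact inj pres \<open>k > 0\<close> S0)+
        then show ?thesis by (intro cong_diff cong_refl)
      qed
      finally show ?thesis by (simp add: cong_0_iff)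
    qed
    moreover have "degree (T - [:S k:]) \<le> N"
      unfolding T_def
      by (intro degree_diff_le degree_sum_le order.trans[OF degree_pcompose_le]
            order.trans[OF degree_smult_le]) (use deg_qk assms(2) finite_subset in auto)
    moreover have "inj_on (\<lambda>x. x mod p) {0..<p}" by (auto simp: inj_on_def)
    \<comment> \<open>All p residues are roots modulo p of a polynomial of degree at most N <
      p.\<close>
    ultimately have "p dvd coeff (T - [:S k:]) (N - r)"
      using \<open>N < nat p\<close>
      by (intro prime_dvd_coeff_of_roots_mod[OF assms(1), of "{0..<p}"]) (auto simp del: poly_diff)
    \<comment> \<open>The constant \<open>S k\<close> matters only if N = r. Then k = r = 1 is
      impossible, because N = n >= 2 in that case; hence k < r and \<open>S k\<close> vanishes
      modulo p.\<close>
    moreover have "p dvd coeff [:S k:] (N - r)"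
    proof (cases "N - r")
      case 0
      then have "k < r" using k_le n by (auto simp: N_def)
      then have "p dvd S k" unfolding S_def using r(4) \<open>k > 0\<close> by blast
      with 0 show ?thesis by (simp only: coeff_pCons_0)
    next
      case (Suc m)
      then show ?thesis by (simp only: coeff_pCons_Suc coeff_0 dvd_0_right)
    qed
    ultimately have "p dvd coeff T (N - r)"
      by (simp add: dvd_diff_left_iff)
    with T_coeff show False by contradiction
  qed
  then have "poly q x = coeff q 1 * x + coeff q 0" for x
    by (cases "n = 0") (auto simp: poly_altdef n_def[symmetric] atMost_Suc le_Suc_eq coeff_eq_0)
  then show ?thesis using q(2) by (metis cong_sym)
qed

section \<open>Identifying the permuted set with the residues modulo p\<close>

text \<open>The period of \<open>x\<close> under \<open>c\<close> divides p and is not 1, so the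
  orbit of \<open>x\<close> has p elements and fills \<Omega>. The identification with Z/p is
  encoded as a map \<open>e\<close> from the integers whose fibres are the residue classes.\<close>

lemma prime_period_coordinates:
  fixes p :: nat
  assumes "Factorial_Ring.prime p" "card \<Omega> = p" "c \<in> \<Omega> \<rightarrow> \<Omega>"
    and period: "\<And>x. x \<in> \<Omega> \<Longrightarrow> (c ^^ p) x = x"
    and x: "x \<in> \<Omega>" "c x \<noteq> x"
  obtains e :: "int \<Rightarrow> 'a" where "range e = \<Omega>"
    "\<And>i j. e i = e j \<longleftrightarrow> [i = j] (mod int p)" "\<And>i. c (e i) = e (i + 1)"
proof -
  have p: "p > 1" using assms(1) by (rule prime_gt_1_nat)
  define E where "E n = (c ^^ n) x" for n
  define e where "e i = E (nat (i mod int p))" for i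
  have E_mod: "E (n mod p) = E n" for n
    unfolding E_def using period[OF x(1)] by (rule funpow_mod_eq)
  have E_in: "E n \<in> \<Omega>" for n
    unfolding E_def by (induction n) (use assms(3) x in auto)
  have E_neq: False if mn: "m < n" "n < p" "E m = E n" for m n
  proof -
    define d where "d = n - m"
    \<comment> \<open>Applying \<open>c ^^ (p - m)\<close> to both sides cancels
      \<open>c ^^ m\<close>, because p is a period; thus d is a period of \<open>x\<close> as
      well.\<close>
    have "E (p - m + m) = E (p - m + n)"
      using mn(3) by (simp only: E_def funpow_add o_apply)
    moreover have "p - m + m = p" "p - m + n = d + p" using mn by (auto simp: d_def)
    ultimately have "E p = E (d + p)" by simp
    then have d: "(c ^^ d) x = x"
      using E_mod[of p] E_mod[of "d + p"] E_mod[of d] by (simp add: E_def)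
    have "0 < d" "d < p" using mn by (auto simp: d_def)
    then have "coprime d p"
      using assms(1) by (meson coprime_commute nat_dvd_not_less prime_imp_coprime)
    \<comment> \<open>Since d a = p b + 1, the point \<open>E (d * a)\<close> is \<open>c x\<close>
      by the period p and \<open>x\<close> by the period d.\<close>
    with \<open>0 < d\<close> obtain a b where ab: "d * a = p * b + 1"
      using bezout_nat[of d p] by (auto simp: coprime_iff_gcd_eq_1)
    have "(p * b + 1) mod p = 1" using p by (subst mod_mult_self4) simp
    then have "c x = E ((p * b + 1) mod p)" by (simp only: E_def) simp
    also have "\<dots> = E (d * a)" by (simp only: E_mod ab)
    also have "\<dots> = E ((d * a) mod d)"
      unfolding E_def by (rule funpow_mod_eq[OF d, symmetric])
    also have "\<dots> = x" by (simp add: E_def)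
    finally show False using x by simp
  qed
  have e_eq: "e i = e j \<longleftrightarrow> [i = j] (mod int p)" for i j
  proof
    assume "e i = e j"
    moreover have "nat (i mod int p) < p" "nat (j mod int p) < p"
      using p by (auto simp: nat_less_iff)
    ultimately have "nat (i mod int p) = nat (j mod int p)"
      unfolding e_def by (metis E_neq linorder_neqE_nat)
    then show "[i = j] (mod int p)"
      using p by (simp add: cong_def eq_nat_nat_iff)
  qed (simp add: e_def cong_def)
  show thesis
  proof (rule that)
    show "c (e i) = e (i + 1)" for i
    proof -
      have "c (e i) = E (Suc (nat (i mod int p)) mod p)"
        unfolding e_def E_mod by (simp add: E_def)
      also have "Suc (nat (i mod int p)) mod p = nat ((i mod int p + 1) mod int p)"
        using p by (simp add: nat_mod_distrib Suc_nat_eq_nat_zadd1 add.commute)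
      finally show ?thesis by (simp add: e_def mod_add_left_eq)
    qed
    have "finite \<Omega>" using assms(2) p by (metis card.infinite not_one_less_zero)
    moreover have "e ` {0..<int p} \<subseteq> \<Omega>" using E_in by (auto simp: e_def)
    moreover have "inj_on e {0..<int p}"
      by (auto simp: inj_on_def e_eq cong_def)
    ultimately have "e ` {0..<int p} = \<Omega>"
      using assms(2) by (intro card_subset_eq) (auto simp: card_image)
    moreover have "range e \<subseteq> \<Omega>" using E_in by (auto simp: e_def)
    ultimately show "range e = \<Omega>" by blast
  qed (rule e_eq)
qed

lemma mult_BijGroup_apply:
  assumes "g \<in> Bij \<Omega>" "h \<in> Bij \<Omega>" "x \<in> \<Omega>"
  shows "(g \<otimes>\<^bsub>BijGroup \<Omega>\<^esub> h) x = g (h x)"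
  using assms by (simp add: BijGroup_def compose_def)

lemma nat_pow_BijGroup_apply:
  assumes "g \<in> Bij \<Omega>" "x \<in> \<Omega>"
  shows "(g [^]\<^bsub>BijGroup \<Omega>\<^esub> (n::nat)) x = (g ^^ n) x"
  using assms(2)
proof (induction n arbitrary: x)
  case 0
  then show ?case by (simp add: BijGroup_def)
next
  case (Suc n)
  interpret B: group "BijGroup \<Omega>" by (rule group_BijGroup)
  have "g [^]\<^bsub>BijGroup \<Omega>\<^esub> n \<in> Bij \<Omega>"
    using assms(1) B.nat_pow_closed[of g n] by (simp add: BijGroup_def)
  moreover have "g x \<in> \<Omega>" using assms(1) Suc.prems Bij_imp_funcset by blast
  ultimately show ?case
    using Suc assms(1) by (simp add: mult_BijGroup_apply funpow_swap1)
qed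

text \<open>By the orbit-stabilizer theorem p divides the order of G, so Sylow yields a subgroup of
  order p. Any nontrivial element \<open>c\<close> of it has p-th power 1 and moves a point.\<close>

lemma transitive_prime_degree_coordinates:
  fixes p :: nat
  assumes "Factorial_Ring.prime p" "card \<Omega> = p" "subgroup G (BijGroup \<Omega>)"
    and "transitive_perm_group \<Omega> G"
  obtains c and e :: "int \<Rightarrow> 'a" where "c \<in> G" "range e = \<Omega>"
    "\<And>i j. e i = e j \<longleftrightarrow> [i = j] (mod int p)" "\<And>i. c (e i) = e (i + 1)"
proof -
  interpret B: group "BijGroup \<Omega>" by (rule group_BijGroup)
  let ?G = "(BijGroup \<Omega>)\<lparr>carrier := G\<rparr>"
  interpret act: transitive_action ?G \<Omega> "\<lambda>g. g"
    using assms(4) by (simp add: transitive_perm_group_def)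
  interpret G: group ?G using assms(3) by (rule B.subgroup_imp_group)
  have p: "p > 1" using assms(1) by (rule prime_gt_1_nat)
  have fin: "finite \<Omega>" using assms(2) p by (metis card.infinite not_one_less_zero)
  have GB: "G \<subseteq> Bij \<Omega>" using subgroup.subset[OF assms(3)] by (simp add: BijGroup_def)
  have "Bij \<Omega> \<subseteq> \<Omega> \<rightarrow>\<^sub>E \<Omega>" using Bij_imp_funcset by (auto simp: PiE_def Bij_imp_extensional)
  then have fin_G: "finite G"
    using GB finite_PiE[OF fin, of "\<lambda>_. \<Omega>"] fin by (meson finite_subset)
  obtain x where x: "x \<in> \<Omega>" using assms(2) p by fastforce
  have "orbit ?G (\<lambda>g. g) x = \<Omega>"
    using x act.element_image act.unique_orbit by (fastforce simp: orbit_def)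
  \<comment> \<open>The factor \<open>p ^ 1\<close> makes Sylow's theorem produce a subgroup of
    order exactly p.\<close>
  then have "Coset.order ?G = p ^ 1 * card (stabilizer ?G (\<lambda>g. g) x)"
    using act.orbit_stabilizer_theorem[OF x] assms(2) by simp
  then obtain H where H: "subgroup H ?G" "card H = p"
    using sylow_thm[OF assms(1) G.is_group] fin_G by fastforce
  have "\<exists>c\<in>H. c \<noteq> \<one>\<^bsub>?G\<^esub>"
  proof (rule ccontr)
    assume "\<not> ?thesis"
    then have "card H \<le> card {\<one>\<^bsub>?G\<^esub>}" by (intro card_mono) auto
    then show False using H p by simp
  qed
  then obtain c where c: "c \<in> H" "c \<noteq> \<one>\<^bsub>?G\<^esub>" by blast
  have cG: "c \<in> G" using c(1) subgroup.subset[OF H(1)] by auto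
  interpret H: group "?G\<lparr>carrier := H\<rparr>" using H(1) by (rule G.subgroup_imp_group)
  have "c [^]\<^bsub>?G\<lparr>carrier := H\<rparr>\<^esub> p = \<one>\<^bsub>?G\<^esub>"
    using H.pow_order_eq_1[of c] c H by (simp add: Coset.order_def)
  then have "c [^]\<^bsub>BijGroup \<Omega>\<^esub> p = \<one>\<^bsub>BijGroup \<Omega>\<^esub>"
    by (simp add: nat_pow_def)
  then have period: "(c ^^ p) y = y" if "y \<in> \<Omega>" for y
    using nat_pow_BijGroup_apply[of c \<Omega> y p] cG GB that by (auto simp: BijGroup_def)
  \<comment> \<open>By extensionality, an element fixing all of \<Omega> would be the identity of
    \<open>BijGroup \<Omega>\<close>.\<close>
  have "\<exists>y\<in>\<Omega>. c y \<noteq> y"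
  proof (rule ccontr)
    assume "\<not> ?thesis"
    moreover have "c \<in> extensional \<Omega>" using cG GB by (auto simp: Bij_def)
    ultimately have "c = (\<lambda>x\<in>\<Omega>. x)" by (auto simp: extensional_def fun_eq_iff)
    then show False using c by (simp add: BijGroup_def)
  qed
  then obtain y where y: "y \<in> \<Omega>" "c y \<noteq> y" by blast
  have "c \<in> \<Omega> \<rightarrow> \<Omega>" using cG GB Bij_imp_funcset by blast
  then show thesis
    by (rule prime_period_coordinates[OF assms(1,2) _ period y]) (assumption, rule that[OF cG])
qed

section \<open>Solvability of groups of affine maps\<close>

text \<open>Commutators of affine maps are translations and translations commute, so the second
  derived subgroup is trivial.\<close>

lemma solvable_of_affine_coordinates:
  fixes e :: "int \<Rightarrow> 'a"
  assumes "subgroup G (BijGroup \<Omega>)" "range e = \<Omega>"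
    and e_eq: "\<And>i j. e i = e j \<longleftrightarrow> [i = j] (mod m)"
    and affine: "\<And>g. g \<in> G \<Longrightarrow> \<exists>a b. \<forall>i. g (e i) = e (a * i + b)"
  shows "solvable ((BijGroup \<Omega>)\<lparr>carrier := G\<rparr>)"
proof -
  interpret B: group "BijGroup \<Omega>" by (rule group_BijGroup)
  define G' where "G' = (BijGroup \<Omega>)\<lparr>carrier := G\<rparr>"
  interpret G: group G' unfolding G'_def using assms(1) by (rule B.subgroup_imp_group)
  have carrier: "carrier G' = G" by (simp add: G'_def)
  have GB: "G \<subseteq> Bij \<Omega>" using subgroup.subset[OF assms(1)] by (simp add: BijGroup_def)
  have mult: "(g \<otimes>\<^bsub>G'\<^esub> h) (e i) = g (h (e i))" if "g \<in> G" "h \<in> G" for g h i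
    using that GB assms(2) mult_BijGroup_apply[of g \<Omega> h "e i"] by (auto simp: G'_def)
  have one: "\<one>\<^bsub>G'\<^esub> (e i) = e i" for i
    using assms(2) by (auto simp: G'_def BijGroup_def)
  have eqI: "g = h" if "g \<in> G" "h \<in> G" "\<And>i. g (e i) = h (e i)" for g h
    using that GB assms(2) by (intro extensionalityI[of g \<Omega> h]) (auto simp: Bij_def)
  \<comment> \<open>The translations contained in G.\<close>
  define K where "K = {g \<in> G. \<exists>b. \<forall>i. g (e i) = e (i + b)}"
  have K: "subgroup K G'"
  proof (rule G.subgroupI)
    show "K \<subseteq> carrier G'" by (auto simp: K_def carrier)
    have "\<one>\<^bsub>G'\<^esub> \<in> K" using G.one_closed carrier one by (auto simp: K_def intro: exI[of _ 0])
    then show "K \<noteq> {}" by blast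
  next
    fix g assume "g \<in> K"
    then obtain b where g: "g \<in> G" "\<And>i. g (e i) = e (i + b)" by (auto simp: K_def)
    have inv: "inv\<^bsub>G'\<^esub> g \<in> G" using g G.inv_closed carrier by auto
    have "(inv\<^bsub>G'\<^esub> g) (e i) = e (i + (- b))" for i
      using mult[OF inv g(1), of "i - b"] g G.l_inv[of g] carrier one by simp
    then show "inv\<^bsub>G'\<^esub> g \<in> K" using inv unfolding K_def by blast
  next
    fix g h assume "g \<in> K" "h \<in> K"
    then obtain b b' where g: "g \<in> G" "\<And>i. g (e i) = e (i + b)"
      and h: "h \<in> G" "\<And>i. h (e i) = e (i + b')" by (auto simp: K_def)
    have "(g \<otimes>\<^bsub>G'\<^esub> h) (e i) = e (i + (b' + b))" for i
      using mult[OF g(1) h(1)] g h by (simp add: add.assoc)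
    then show "g \<otimes>\<^bsub>G'\<^esub> h \<in> K" using G.m_closed[of g h] g h carrier by (auto simp: K_def)
  qed
  \<comment> \<open>A commutator \<open>k\<close> of \<open>g\<close> and \<open>h\<close> is
    handled through k (h g) = g h, which avoids computing affine forms of inverses.\<close>
  have comm: "k \<otimes>\<^bsub>G'\<^esub> (h \<otimes>\<^bsub>G'\<^esub> g) = g \<otimes>\<^bsub>G'\<^esub> h" "k \<in> G"
    if "g \<in> G" "h \<in> G" "k = g \<otimes>\<^bsub>G'\<^esub> h \<otimes>\<^bsub>G'\<^esub> inv\<^bsub>G'\<^esub> g \<otimes>\<^bsub>G'\<^esub> inv\<^bsub>G'\<^esub> h" for g h k
  proof -
    have gh: "g \<in> carrier G'" "h \<in> carrier G'" using that carrier by auto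
    then have "inv\<^bsub>G'\<^esub> h \<otimes>\<^bsub>G'\<^esub> (h \<otimes>\<^bsub>G'\<^esub> g) = g"
      by (simp flip: G.m_assoc)
    then show "k \<otimes>\<^bsub>G'\<^esub> (h \<otimes>\<^bsub>G'\<^esub> g) = g \<otimes>\<^bsub>G'\<^esub> h"
      using that(3) gh by (simp add: G.m_assoc)
    show "k \<in> G" using gh that(3) carrier by auto
  qed
  have "derived_set G' G \<subseteq> K"
  proof clarify
    fix g h assume gh: "g \<in> G" "h \<in> G"
    define k where "k = g \<otimes>\<^bsub>G'\<^esub> h \<otimes>\<^bsub>G'\<^esub> inv\<^bsub>G'\<^esub> g \<otimes>\<^bsub>G'\<^esub> inv\<^bsub>G'\<^esub> h"
    note k = comm[OF gh k_def]
    obtain a b where g: "\<And>i. g (e i) = e (a * i + b)" using affine[OF gh(1)] by blast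
    obtain a' b' where h: "\<And>i. h (e i) = e (a' * i + b')" using affine[OF gh(2)] by blast
    have hg: "h \<otimes>\<^bsub>G'\<^esub> g \<in> G" using gh carrier G.m_closed by blast
    have k_eq: "k (e (a' * (a * i + b) + b')) = e (a * (a' * i + b') + b)" for i
      using mult[OF k(2) hg] mult[OF gh] mult[OF gh(2,1)] k(1) g h by metis
    have "k (e j) = e (j + (a * b' + b - a' * b - b'))" for j
    proof -
      \<comment> \<open>As h g is onto, every point is h g (\<open>e i\<close>) for some i. The
        difference of the coordinates of g h (\<open>e i\<close>) and h g (\<open>e i\<close>) does
        not depend on i, so \<open>k\<close> is a translation.\<close>
      have "e j \<in> (h \<otimes>\<^bsub>G'\<^esub> g) ` \<Omega>"
        using hg GB assms(2) by (auto simp: Bij_def bij_betw_def)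
      then obtain i where i: "e j = e (a' * (a * i + b) + b')"
        using assms(2) mult[OF gh(2,1)] g h by auto
      then have "[j + (a * b' + b - a' * b - b') =
          a' * (a * i + b) + b' + (a * b' + b - a' * b - b')] (mod m)"
        using e_eq by (intro cong_add) auto
      then have "e (j + (a * b' + b - a' * b - b')) = e (a * (a' * i + b') + b)"
        unfolding e_eq by (simp add: algebra_simps)
      then show ?thesis using k_eq i by simp
    qed
    then show "g \<otimes>\<^bsub>G'\<^esub> h \<otimes>\<^bsub>G'\<^esub> inv\<^bsub>G'\<^esub> g \<otimes>\<^bsub>G'\<^esub> inv\<^bsub>G'\<^esub> h \<in> K"
      using k(2) unfolding k_def[symmetric] K_def by blast
  qed
  then have dG: "derived G' G \<subseteq> K"
    unfolding derived_def using K by (rule G.generate_subgroup_incl)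
  have "derived_set G' K \<subseteq> {\<one>\<^bsub>G'\<^esub>}"
  proof clarify
    fix g h assume "g \<in> K" "h \<in> K"
    then obtain b b' where g: "g \<in> G" "\<And>i. g (e i) = e (i + b)"
      and h: "h \<in> G" "\<And>i. h (e i) = e (i + b')" by (auto simp: K_def)
    define k where "k = g \<otimes>\<^bsub>G'\<^esub> h \<otimes>\<^bsub>G'\<^esub> inv\<^bsub>G'\<^esub> g \<otimes>\<^bsub>G'\<^esub> inv\<^bsub>G'\<^esub> h"
    note k = comm[OF g(1) h(1) k_def]
    have "g \<otimes>\<^bsub>G'\<^esub> h = h \<otimes>\<^bsub>G'\<^esub> g"
      using g h carrier G.m_closed mult by (intro eqI) (auto simp: algebra_simps)
    then have "k \<otimes>\<^bsub>G'\<^esub> (g \<otimes>\<^bsub>G'\<^esub> h) = g \<otimes>\<^bsub>G'\<^esub> h" using k by simp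
    then show "g \<otimes>\<^bsub>G'\<^esub> h \<otimes>\<^bsub>G'\<^esub> inv\<^bsub>G'\<^esub> g \<otimes>\<^bsub>G'\<^esub> inv\<^bsub>G'\<^esub> h = \<one>\<^bsub>G'\<^esub>"
      using k(2) g h carrier G.r_cancel_one' unfolding k_def[symmetric] by auto
  qed
  then have dK: "derived G' K \<subseteq> {\<one>\<^bsub>G'\<^esub>}"
    unfolding derived_def using G.triv_subgroup by (rule G.generate_subgroup_incl)
  have "derived G' (derived G' G) \<subseteq> {\<one>\<^bsub>G'\<^esub>}"
    using G.mono_derived[OF dG] dK K subgroup.subset by blast
  moreover have "\<one>\<^bsub>G'\<^esub> \<in> derived G' (derived G' G)"
    unfolding derived_def by (rule generate.one)
  ultimately have "(derived G' ^^ 2) (carrier G') = {\<one>\<^bsub>G'\<^esub>}"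
    by (auto simp: carrier numeral_2_eq_2)
  then show ?thesis
    using G.solvable_iff_trivial_derived_seq unfolding G'_def by blast
qed

section \<open>Small invariant relations when double transitivity fails\<close>

theorem mainTheorem1:
  fixes p :: nat and \<Omega> :: "'a set" and G :: "('a \<Rightarrow> 'a) set"
  assumes "Factorial_Ring.prime p"
    and "card \<Omega> = p"
    and "subgroup G (BijGroup \<Omega>)"
    and "transitive_perm_group \<Omega> G"
  shows "doubly_transitive \<Omega> G \<or> solvable ((BijGroup \<Omega>)\<lparr>carrier := G\<rparr>)"
proof (cases "doubly_transitive \<Omega> G")
  case False
  then obtain i\<^sub>0 j\<^sub>0 k\<^sub>0 l\<^sub>0 where ijkl: "i\<^sub>0 \<in> \<Omega>" "j\<^sub>0 \<in> \<Omega>" "k\<^sub>0 \<in> \<Omega>" "l\<^sub>0 \<in> \<Omega>" "i\<^sub>0 \<noteq> j\<^sub>0" "k\<^sub>0 \<noteq> l\<^sub>0"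
    and no_g: "\<not> (\<exists>g\<in>G. g i\<^sub>0 = k\<^sub>0 \<and> g j\<^sub>0 = l\<^sub>0)"
    unfolding doubly_transitive_iff[OF assms(3)] by blast
  obtain c and e :: "int \<Rightarrow> 'a" where c: "c \<in> G" and e: "range e = \<Omega>"
    and e_eq: "\<And>i j. e i = e j \<longleftrightarrow> [i = j] (mod int p)" and c_e: "\<And>i. c (e i) = e (i + 1)"
    using transitive_prime_degree_coordinates[OF assms] by blast
  have p: "p > 1" using assms(1) by (rule prime_gt_1_nat)
  have p_int: "Factorial_Ring.prime (int p)" using assms(1) by simp
  interpret B: group "BijGroup \<Omega>" by (rule group_BijGroup)
  interpret G: subgroup G "BijGroup \<Omega>" by fact
  have GB: "G \<subseteq> Bij \<Omega>" using G.subset by (simp add: BijGroup_def)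
  have e_in: "e i \<in> \<Omega>" for i using e by blast
  define invariant where "invariant D \<longleftrightarrow>
    (\<forall>h\<in>G. \<forall>a\<in>\<Omega>. \<forall>b\<in>\<Omega>. D (h a) (h b) \<longleftrightarrow> D a b)" for D :: "'a \<Rightarrow> 'a \<Rightarrow> bool"
  \<comment> \<open>The nonzero differences of pairs related by \<open>D\<close>. Leaving out 0
    ignores the diagonal, on which a relation and its complement behave differently.\<close>
  define W where "W D = {u \<in> {0<..<int p}. D (e u) (e 0)}" for D
  \<comment> \<open>Since \<open>c\<close> is translation by 1, an invariant relation depends only
    on the difference of coordinates. The induction runs over natural shifts, and x is replaced by
    its nonnegative residue.\<close>
  have shift: "D (e (x + u)) (e x) \<longleftrightarrow> D (e u) (e 0)" if D: "invariant D" for D x u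
  proof -
    have "D (e (int n + u)) (e (int n)) \<longleftrightarrow> D (e u) (e 0)" for n
    proof (induction n)
      case (Suc n)
      have "D (e (int (Suc n) + u)) (e (int (Suc n))) \<longleftrightarrow> D (c (e (int n + u))) (c (e (int n)))"
        by (simp add: c_e add.commute add.left_commute)
      also have "\<dots> \<longleftrightarrow> D (e (int n + u)) (e (int n))"
        using D c e_in by (simp add: invariant_def)
      finally show ?case using Suc by simp
    qed simp
    moreover obtain n where "int n = x mod int p"
      using p nonneg_int_cases[of "x mod int p"] by fastforce
    then have "e x = e (int n)" "e (x + u) = e (int n + u)"
      by (auto simp: e_eq cong_def mod_add_left_eq)
    ultimately show ?thesis by simp
  qed
  have in_W: "(x - y) mod int p \<in> W D"
    if "invariant D" "D (e x) (e y)" "e x \<noteq> e y" for D x y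
  proof -
    have "(x - y) mod int p \<noteq> 0"
      using that(3) by (auto simp: e_eq cong_iff_dvd_diff)
    moreover have "(x - y) mod int p \<ge> 0" "(x - y) mod int p < int p" using p by auto
    moreover have "e ((x - y) mod int p) = e (x - y)" by (simp add: e_eq cong_def)
    ultimately show ?thesis
      using that(2) shift[OF that(1), of y "x - y"] by (auto simp: W_def)
  qed
  \<comment> \<open>Stated for an arbitrary invariant relation, so that it applies to an orbit on
    pairs and also to its complement.\<close>
  have main: ?thesis if D: "invariant D" and W: "W D \<noteq> {}" "2 * int (card (W D)) < int p" for D
  proof (rule disjI2, rule solvable_of_affine_coordinates[OF assms(3) e e_eq])
    fix g assume g: "g \<in> G"
    have "\<exists>j. e j = g (e i)" for i
      using g GB Bij_imp_funcset e_in e by (metis Pi_mem rangeE subsetD)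
    \<comment> \<open>A choice of integer coordinates for the action of \<open>g\<close>, unique
      only modulo p.\<close>
    then obtain f where f: "\<And>i. e (f i) = g (e i)" by metis
    have g_inj: "g (e i) = g (e j) \<longleftrightarrow> e i = e j" for i j
      using g GB e_in by (auto simp: Bij_def bij_betw_def inj_on_def)
    have f_cong: "[f i = f j] (mod int p) \<longleftrightarrow> [i = j] (mod int p)" for i j
      using e_eq f g_inj by metis
    have "\<exists>a b. \<forall>x. [f x = a * x + b] (mod int p)"
    proof (rule affine_mod_prime_of_preserves_differences[OF p_int _ W])
      show "W D \<subseteq> {0<..<int p}" by (auto simp: W_def)
      show "[f (x mod int p) = f x] (mod int p)" for x
        unfolding f_cong by (simp add: cong_def)
      show "[x = y] (mod int p)" if "[f x = f y] (mod int p)" for x y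
        using that f_cong by simp
      show "(f (x + u) - f x) mod int p \<in> W D" if u: "u \<in> W D" for x u
      proof (rule in_W[OF D])
        have "D (e (x + u)) (e x)" using u shift[OF D] by (simp add: W_def)
        then show "D (e (f (x + u))) (e (f x))"
          using D g e_in by (simp add: f invariant_def)
        have "\<not> int p dvd u" using u by (auto simp: W_def zdvd_not_zless)
        then have "\<not> [x + u = x] (mod int p)" by (simp add: cong_iff_dvd_diff)
        then show "e (f (x + u)) \<noteq> e (f x)" by (simp add: e_eq f_cong)
      qed
    qed
    then show "\<exists>a b. \<forall>i. g (e i) = e (a * i + b)"
      by (metis f e_eq)
  qed
  \<comment> \<open>The orbit of the pair (\<open>i\<^sub>0\<close>, \<open>j\<^sub>0\<close>),
    which misses (\<open>k\<^sub>0\<close>, \<open>l\<^sub>0\<close>).\<close>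
  define D where "D a b \<longleftrightarrow> (\<exists>g\<in>G. g i\<^sub>0 = a \<and> g j\<^sub>0 = b)" for a b
  have mult: "(g \<otimes>\<^bsub>BijGroup \<Omega>\<^esub> h) x = g (h x)" if "g \<in> G" "h \<in> G" "x \<in> \<Omega>" for g h x
    using that GB by (intro mult_BijGroup_apply) auto
  have D_mono: "D (h a) (h b)" if "h \<in> G" "D a b" for h a b
  proof -
    obtain g where g: "g \<in> G" "g i\<^sub>0 = a" "g j\<^sub>0 = b" using \<open>D a b\<close> unfolding D_def by blast
    then have "(h \<otimes>\<^bsub>BijGroup \<Omega>\<^esub> g) i\<^sub>0 = h a" "(h \<otimes>\<^bsub>BijGroup \<Omega>\<^esub> g) j\<^sub>0 = h b"
      using mult[OF \<open>h \<in> G\<close> g(1)] ijkl by auto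
    then show ?thesis using G.m_closed[OF \<open>h \<in> G\<close> g(1)] unfolding D_def by blast
  qed
  have inv_D: "invariant D"
    unfolding invariant_def
  proof (intro ballI iffI)
    fix h a b assume h: "h \<in> G" "a \<in> \<Omega>" "b \<in> \<Omega>" "D (h a) (h b)"
    have inv: "inv\<^bsub>BijGroup \<Omega>\<^esub> h \<in> G" using h(1) by (rule G.m_inv_closed)
    have "(inv\<^bsub>BijGroup \<Omega>\<^esub> h) (h x) = x" if "x \<in> \<Omega>" for x
      using mult[OF inv h(1) that] B.l_inv[of h] h(1) G.subset that
      by (auto simp: BijGroup_def)
    then show "D a b" using D_mono[OF inv h(4)] h by simp
  qed (rule D_mono)
  then have inv_not_D: "invariant (\<lambda>a b. \<not> D a b)" by (simp add: invariant_def)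
  have "D i\<^sub>0 j\<^sub>0"
    unfolding D_def using G.one_closed ijkl by (intro bexI[of _ "\<one>\<^bsub>BijGroup \<Omega>\<^esub>"]) (auto simp: BijGroup_def)
  moreover obtain i j k l where "i\<^sub>0 = e i" "j\<^sub>0 = e j" "k\<^sub>0 = e k" "l\<^sub>0 = e l"
    using ijkl e by (metis rangeE)
  moreover have "\<not> D k\<^sub>0 l\<^sub>0" using no_g by (simp add: D_def)
  ultimately have ne: "W D \<noteq> {}" "W (\<lambda>a b. \<not> D a b) \<noteq> {}"
    using in_W[OF inv_D, of i j] in_W[OF inv_not_D, of k l] ijkl by auto
  \<comment> \<open>The two difference sets partition the p - 1 nonzero residues, so one of them has
    fewer than p/2 elements.\<close>
  have "W D \<inter> W (\<lambda>a b. \<not> D a b) = {}" "W D \<union> W (\<lambda>a b. \<not> D a b) = {0<..<int p}"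
    by (auto simp: W_def)
  moreover have "finite (W D')" for D' unfolding W_def by (rule finite_subset[of _ "{0<..<int p}"]) auto
  ultimately have "card (W D) + card (W (\<lambda>a b. \<not> D a b)) = card {0<..<int p}"
    by (metis card_Un_disjoint)
  then have "2 * card (W D) < p \<or> 2 * card (W (\<lambda>a b. \<not> D a b)) < p"
    using p by auto
  then show ?thesis
  proof
    assume "2 * card (W D) < p"
    then show ?thesis by (intro main[OF inv_D ne(1)]) linarith
  next
    assume "2 * card (W (\<lambda>a b. \<not> D a b)) < p"
    then show ?thesis by (intro main[OF inv_not_D ne(2)]) linarith
  qed
qed simp

end
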